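(* For every integer $n\geq 1$, the graph $G_n$ (defined in the context) satisfies $\operatorname{IR}(G_n)=2n+1$, and its $\operatorname{IR}$-graph $G_n(\operatorname{IR})$ is isomorphic to the double star $S(2n,2n)$.
   Context: All graphs are finite, simple and undirected. For a graph $G=(V,E)$, a set $D\subseteq V$ and a vertex $v\in D$, a $D$-private neighbour of $v$ is a vertex $v'\in V$ that is dominated by $v$ (i.e. $v'=v$ or $v'$ is adjacent to $v$) but is not dominated by any vertex in $D-\{v\}$. The set of $D$-private neighbours of $v$ is denoted $\operatorname{PN}(v,D)$. The set $D$ is irredundant if $\operatorname{PN}(v,D)\neq\varnothing$ for each $v\in D$. The upper irredundance number $\operatorname{IR}(G)$ is the largest cardinality of an irredundant set of $G$, and an $\operatorname{IR}(G)$-set is an irredundant set of $G$ of cardinality $\operatorname{IR}(G)$. The $\operatorname{IR}$-graph $G(\operatorname{IR})$ of $G$ is the graph whose vertex set consists of all the $\operatorname{IR}(G)$-sets, where sets $D$ and $D'$ are adjacent if and only if there exist vertices $u\in D$ and $v\in D'-\{u\}$ such that $uv\in E(G)$ and $D'=(D-\{u\})\cup\{v\}$. The double star $S(m,m)$ is the tree obtained from two disjoint stars $K_{1,m}$ by joining their central vertices by an edge. The graph $G_n$, $n\geq 1$: its vertex set is the disjoint union of $\{u,v\}$, $A=\{a_1,\dots,a_n\}$, $B=\{b_1,\dots,b_n\}$, $C=\{c_1,\dots,c_n\}$ and $D=\{d_1,\dots,d_n\}$ (so it has $4n+2$ vertices). Its edges are exactly the following: $uv$; $ua_i$ and $vb_i$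 for each $i=1,\dots,n$; $a_ib_j$ for all $i\neq j$ (so $A\cup B$ induces $K_{n,n}$ with partite sets $A$ and $B$ minus the perfect matching $\{a_ib_i : i=1,\dots,n\}$); and, for each $i=1,\dots,n$, the edges $a_ic_i$, $c_ib_i$, $b_id_i$, $d_ia_i$ (so $\{a_i,b_i,c_i,d_i\}$ induces the $4$-cycle $(a_i,c_i,b_i,d_i,a_i)$). *)

theory Defs
  imports Main
begin

record 'v graph =
  verts :: "'v set"
  edges :: "'v set set"

definition simple_graph :: "'v graph \<Rightarrow> bool" where
  "simple_graph G \<longleftrightarrow> finite (verts G) \<and> (\<forall>e\<in>edges G. e \<subseteq> verts G \<and> card e = 2)"

definition adj :: "'v graph \<Rightarrow> 'v \<Rightarrow> 'v \<Rightarrow> bool" where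
  "adj G x y \<longleftrightarrow> {x, y} \<in> edges G"

definition graph_iso :: "'v graph \<Rightarrow> 'w graph \<Rightarrow> bool" where
  "graph_iso G H \<longleftrightarrow>
     (\<exists>f. bij_betw f (verts G) (verts H) \<and>
          (\<forall>x\<in>verts G. \<forall>y\<in>verts G. adj G x y \<longleftrightarrow> adj H (f x) (f y)))"

definition dominates :: "'v graph \<Rightarrow> 'v \<Rightarrow> 'v \<Rightarrow> bool" where
  "dominates G x y \<longleftrightarrow> y = x \<or> adj G x y"

definition PN :: "'v graph \<Rightarrow> 'v \<Rightarrow> 'v set \<Rightarrow> 'v set" where
  "PN G x S = {y \<in> verts G. dominates G x y \<and> (\<forall>z\<in>S - {x}. \<not> dominates G z y)}"

definition irredundant :: "'v graph \<Rightarrow> 'v set \<Rightarrow> bool" where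
  "irredundant G S \<longleftrightarrow> S \<subseteq> verts G \<and> (\<forall>x\<in>S. PN G x S \<noteq> {})"

definition IR :: "'v graph \<Rightarrow> nat" where
  "IR G = Max {card S | S. irredundant G S}"

definition IR_sets :: "'v graph \<Rightarrow> 'v set set" where
  "IR_sets G = {S. irredundant G S \<and> card S = IR G}"

definition IR_graph :: "'v graph \<Rightarrow> 'v set graph" where
  "IR_graph G =
     \<lparr>verts = IR_sets G,
      edges = {{S, T} | S T. S \<in> IR_sets G \<and> T \<in> IR_sets G \<and>
                (\<exists>x\<in>S. \<exists>y\<in>T - {x}. adj G x y \<and> T = (S - {x}) \<union> {y})}\<rparr>"

(* K_{1,m}, with centre 0 *)
definition star :: "nat \<Rightarrow> nat graph" where
  "star m = \<lparr>verts = {0..m}, edges = {{0, i} | i. i \<in> {1..m}}\<rparr>"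

definition double_star :: "nat \<Rightarrow> nat \<Rightarrow> (nat + nat) graph" where
  "double_star k m =
     \<lparr>verts = Inl ` verts (star k) \<union> Inr ` verts (star m),
      edges = (`) Inl ` edges (star k) \<union> (`) Inr ` edges (star m) \<union> {{Inl 0, Inr 0}}\<rparr>"

datatype gvertex = VU | VV | VA nat | VB nat | VC nat | VD nat

definition G_graph :: "nat \<Rightarrow> gvertex graph" where
  "G_graph n =
     \<lparr>verts = {VU, VV} \<union> VA ` {1..n} \<union> VB ` {1..n} \<union> VC ` {1..n} \<union> VD ` {1..n},
      edges = {{VU, VV}}
        \<union> {{VU, VA i} | i. i \<in> {1..n}}
        \<union> {{VV, VB i} | i. i \<in> {1..n}}
        \<union> {{VA i, VB j} | i j. i \<in> {1..n} \<and> j \<in> {1..n} \<and> i \<noteq> j}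
        \<union> {{VA i, VC i} | i. i \<in> {1..n}}
        \<union> {{VC i, VB i} | i. i \<in> {1..n}}
        \<union> {{VB i, VD i} | i. i \<in> {1..n}}
        \<union> {{VD i, VA i} | i. i \<in> {1..n}}\<rparr>"

lemma simple_graph_G_graph: "simple_graph (G_graph n)"
  by (auto simp: simple_graph_def G_graph_def card_insert_if)

lemma simple_graph_double_star: "simple_graph (double_star k m)"
  by (auto simp: simple_graph_def double_star_def star_def card_insert_if)

lemma finite_irredundant:
  assumes "simple_graph G"
  shows "finite {S. irredundant G S}"
  by (rule finite_subset[of _ "Pow (verts G)"])
    (use assms in \<open>auto simp: irredundant_def simple_graph_def\<close>)

lemma IR_attained:
  assumes "simple_graph G"
  shows "\<exists>S. irredundant G S \<and> card S = IR G"
    and "irredundant G S \<Longrightarrow> card S \<le> IR G"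
proof -
  let ?X = "{card S | S. irredundant G S}"
  have X: "?X = card ` {S. irredundant G S}" by auto
  have fin: "finite ?X" using finite_irredundant[OF assms] by (simp add: X)
  have "irredundant G {}" by (simp add: irredundant_def)
  then have "?X \<noteq> {}" by blast
  from Max_in[OF fin this] show "\<exists>S. irredundant G S \<and> card S = IR G"
    unfolding IR_def by auto
  show "irredundant G S \<Longrightarrow> card S \<le> IR G"
    unfolding IR_def by (rule Max_ge[OF fin]) auto
qed

lemma simple_graph_IR_graph:
  assumes "simple_graph G"
  shows "simple_graph (IR_graph G)"
proof -
  have fin: "finite (IR_sets G)"
    using finite_irredundant[OF assms] by (simp add: IR_sets_def)
  have neq: "S \<noteq> T"
    if "S \<in> IR_sets G" "T \<in> IR_sets G" "x \<in> S" "y \<in> T - {x}" "T = (S - {x}) \<union> {y}" for S T x y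
    using that by blast
  have "e \<subseteq> IR_sets G \<and> card e = 2" if "e \<in> edges (IR_graph G)" for e
  proof -
    from that obtain S T where ST: "e = {S, T}" "S \<in> IR_sets G" "T \<in> IR_sets G"
      and ex: "\<exists>x\<in>S. \<exists>y\<in>T - {x}. adj G x y \<and> T = (S - {x}) \<union> {y}"
      unfolding IR_graph_def by auto
    from ex obtain x y where "x \<in> S" "y \<in> T - {x}" "T = (S - {x}) \<union> {y}" by blast
    with neq ST have "S \<noteq> T" by blast
    with ST show ?thesis by simp
  qed
  with fin show ?thesis by (simp add: simple_graph_def IR_graph_def)
qed

lemma adj_IR_graph:
  assumes "simple_graph G" "S \<in> IR_sets G" "T \<in> IR_sets G"
  shows "adj (IR_graph G) S T \<longleftrightarrow>
    (\<exists>x\<in>S. \<exists>y\<in>T - {x}. adj G x y \<and> T = (S - {x}) \<union> {y})"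
proof -
  let ?R = "\<lambda>S T. \<exists>x\<in>S. \<exists>y\<in>T - {x}. adj G x y \<and> T = (S - {x}) \<union> {y}"
  have sym: "?R S T" if "?R T S" "S \<in> IR_sets G" "T \<in> IR_sets G" for S T
  proof -
    from that(1) obtain x y where xy: "x \<in> T" "y \<in> S" "y \<noteq> x" "adj G x y" "S = (T - {x}) \<union> {y}"
      by blast
    have finT: "finite T"
      using that assms(1) unfolding IR_sets_def irredundant_def simple_graph_def
      by (auto intro: finite_subset)
    have c: "card S = card T" using that by (simp add: IR_sets_def)
    have "y \<notin> T"
    proof
      assume "y \<in> T"
      with xy have "S = T - {x}" by blast
      with c finT xy(1) show False by (metis card_Diff1_less less_irrefl)
    qed
    with xy have "T = (S - {y}) \<union> {x}" by blast
    moreover have "adj G y x" using xy(4) by (simp add: adj_def insert_commute)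
    ultimately show ?thesis using xy by blast
  qed
  have "adj (IR_graph G) S T \<longleftrightarrow> ?R S T \<or> ?R T S"
  proof -
    have "adj (IR_graph G) S T \<longleftrightarrow>
        (\<exists>S' T'. {S, T} = {S', T'} \<and> S' \<in> IR_sets G \<and> T' \<in> IR_sets G \<and> ?R S' T')"
      unfolding adj_def[of "IR_graph G"] by (simp add: IR_graph_def)
    also have "\<dots> \<longleftrightarrow> ?R S T \<or> ?R T S"
      using assms(2,3) unfolding doubleton_eq_iff by blast
    finally show ?thesis .
  qed
  with sym assms(2,3) show ?thesis by blast
qed

end

theory Submission
  imports Defs
begin

text \<open>
  An irredundant set contains at most two of the vertices \<open>a\<^sub>i, b\<^sub>i, c\<^sub>i, d\<^sub>i\<close> for each \<open>i\<close>.
  If it contains both \<open>u\<close> and \<open>v\<close>, then their private neighbours \<open>a\<^sub>i\<close> and \<open>b\<^sub>j\<close> force two of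
  these vertices to be missing from blocks \<open>i\<close> and \<open>j\<close>. Hence an irredundant set with at least
  \<open>2n + 1\<close> elements contains exactly one of \<open>u, v\<close>, say \<open>u\<close>, and two vertices of each block.
  Then no \<open>b\<^sub>i\<close> and at most one \<open>a\<^sub>i\<close> occurs, so the set arises from \<open>{u} \<union> C \<union> D\<close> by replacing
  at most one vertex of \<open>C \<union> D\<close> by its neighbour in \<open>A\<close>. The two unmodified sets are the centres of
  the double star, the modified ones its leaves.
\<close>

section \<open>Symmetric notation for the vertices\<close>

text \<open>
  The Booleans make the automorphisms \<open>u \<leftrightarrow> v\<close>, \<open>A \<leftrightarrow> B\<close> and \<open>C \<leftrightarrow> D\<close> visible, so that symmetric
  cases are treated once.
\<close>

definition hub :: "bool \<Rightarrow> gvertex" where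
  "hub b = (if b then VU else VV)"

definition spoke :: "bool \<Rightarrow> nat \<Rightarrow> gvertex" where
  "spoke b i = (if b then VA i else VB i)"

definition rim :: "bool \<Rightarrow> nat \<Rightarrow> gvertex" where
  "rim c i = (if c then VC i else VD i)"

lemma gvertex_cases:
  obtains (hub) b where "x = hub b" | (spoke) b i where "x = spoke b i" | (rim) c i where "x = rim c i"
proof (cases x)
  case VU then show ?thesis using hub[of True] by (simp add: hub_def)
next
  case VV then show ?thesis using hub[of False] by (simp add: hub_def)
next
  case (VA i) then show ?thesis using spoke[of True] by (simp add: spoke_def)
next
  case (VB i) then show ?thesis using spoke[of False] by (simp add: spoke_def)
next
  case (VC i) then show ?thesis using rim[of True] by (simp add: rim_def)
next
  case (VD i) then show ?thesis using rim[of False] by (simp add: rim_def)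
qed

lemma gvertex_simps [simp]:
  "hub b = hub b' \<longleftrightarrow> b = b'"
  "spoke b i = spoke b' j \<longleftrightarrow> b = b' \<and> i = j"
  "rim c i = rim c' j \<longleftrightarrow> c = c' \<and> i = j"
  "hub b \<noteq> spoke b' j" "spoke b' j \<noteq> hub b"
  "hub b \<noteq> rim c j" "rim c j \<noteq> hub b"
  "spoke b i \<noteq> rim c j" "rim c j \<noteq> spoke b i"
  by (simp_all add: hub_def spoke_def rim_def)

lemma verts_G_graph [simp]:
  "hub b \<in> verts (G_graph n)"
  "spoke b i \<in> verts (G_graph n) \<longleftrightarrow> i \<in> {1..n}"
  "rim c i \<in> verts (G_graph n) \<longleftrightarrow> i \<in> {1..n}"
  by (auto simp: hub_def spoke_def rim_def G_graph_def)

lemma adj_G_graph [simp]: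
  "adj (G_graph n) (hub b) (hub b') \<longleftrightarrow> b \<noteq> b'"
  "adj (G_graph n) (hub b) (spoke b' j) \<longleftrightarrow> b = b' \<and> j \<in> {1..n}"
  "adj (G_graph n) (spoke b' j) (hub b) \<longleftrightarrow> b = b' \<and> j \<in> {1..n}"
  "\<not> adj (G_graph n) (hub b) (rim c j)"
  "\<not> adj (G_graph n) (rim c j) (hub b)"
  "adj (G_graph n) (spoke b i) (spoke b' j) \<longleftrightarrow> b \<noteq> b' \<and> i \<noteq> j \<and> i \<in> {1..n} \<and> j \<in> {1..n}"
  "adj (G_graph n) (spoke b i) (rim c j) \<longleftrightarrow> i = j \<and> i \<in> {1..n}"
  "adj (G_graph n) (rim c j) (spoke b i) \<longleftrightarrow> i = j \<and> i \<in> {1..n}"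
  "\<not> adj (G_graph n) (rim c i) (rim c' j)"
  by (auto simp: adj_def hub_def spoke_def rim_def G_graph_def doubleton_eq_iff)

section \<open>Candidate sets and their irredundance\<close>

definition rims :: "nat \<Rightarrow> gvertex set" where
  "rims n = (\<Union>i\<in>{1..n}. {rim True i, rim False i})"

definition centre :: "nat \<Rightarrow> bool \<Rightarrow> gvertex set" where
  "centre n b = insert (hub b) (rims n)"

definition leaf :: "nat \<Rightarrow> bool \<Rightarrow> bool \<Rightarrow> nat \<Rightarrow> gvertex set" where
  "leaf n b c i = insert (hub b) (insert (spoke b i) (rims n - {rim c i}))"

lemma mem_rims [simp]:
  "rim c i \<in> rims n \<longleftrightarrow> i \<in> {1..n}" "hub b \<notin> rims n" "spoke b i \<notin> rims n"
  by (cases c) (auto simp: rims_def)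

lemma card_rims: "card (rims n) = 2 * n"
  by (simp add: rims_def card_UN_disjoint mult.commute)

lemma finite_rims: "finite (rims n)"
  by (simp add: rims_def)

text \<open>In this form, any second dominator of \<open>y\<close> in \<open>S\<close> refutes
  \<open>y\<close> as a private neighbour of \<open>x\<close>.\<close>

lemma irredundant_iff:
  "irredundant G S \<longleftrightarrow> S \<subseteq> verts G \<and>
    (\<forall>x\<in>S. \<exists>y\<in>verts G. dominates G x y \<and> (\<forall>z\<in>S. dominates G z y \<longrightarrow> z = x))"
  unfolding irredundant_def PN_def by blast

lemma card_centre: "card (centre n b) = 2 * n + 1"
  by (simp add: centre_def card_rims finite_rims)

lemma card_leaf: "i \<in> {1..n} \<Longrightarrow> card (leaf n b c i) = 2 * n + 1"
  by (simp add: leaf_def card_rims finite_rims card_insert_if)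

lemma mem_centre [simp]:
  "hub b' \<in> centre n b \<longleftrightarrow> b' = b" "spoke b' i \<notin> centre n b"
  "rim c i \<in> centre n b \<longleftrightarrow> i \<in> {1..n}"
  by (simp_all add: centre_def)

lemma mem_leaf [simp]:
  "hub b' \<in> leaf n b c i \<longleftrightarrow> b' = b"
  "spoke b' j \<in> leaf n b c i \<longleftrightarrow> b' = b \<and> j = i"
  "rim c' j \<in> leaf n b c i \<longleftrightarrow> j \<in> {1..n} \<and> (c', j) \<noteq> (c, i)"
  by (auto simp: leaf_def)

text \<open>A hub and the rim vertices are pairwise non-adjacent, so each is its own private
  neighbour.\<close>

lemma irredundant_centre: "irredundant (G_graph n) (centre n b)"
proof -
  let ?G = "G_graph n"
  have "\<exists>y\<in>verts ?G. dominates ?G x y \<and> (\<forall>z\<in>centre n b. dominates ?G z y \<longrightarrow> z = x)"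
    if "x \<in> centre n b" for x
  proof (rule bexI)
    show "dominates ?G x x \<and> (\<forall>z\<in>centre n b. dominates ?G z x \<longrightarrow> z = x)"
    proof (intro conjI ballI impI)
      fix z assume "z \<in> centre n b" "dominates ?G z x"
      with that show "z = x"
        by (cases x rule: gvertex_cases; cases z rule: gvertex_cases) (auto simp: dominates_def)
    qed (simp add: dominates_def)
    show "x \<in> verts ?G" using that by (cases x rule: gvertex_cases) auto
  qed
  moreover have "x \<in> verts ?G" if "x \<in> centre n b" for x
    using that by (cases x rule: gvertex_cases) auto
  ultimately show ?thesis unfolding irredundant_iff by blast
qed

text \<open>As private neighbour, \<open>p\<close> gives \<open>hub b\<close> the other hub,
  \<open>spoke b i\<close> the removed rim vertex, and the other rim vertex of index
  \<open>i\<close> the opposite spoke, which \<open>spoke b i\<close> does not dominate because the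
  matching edge is missing. The remaining rim vertices keep themselves.\<close>

lemma irredundant_leaf:
  assumes i: "i \<in> {1..n}"
  shows "irredundant (G_graph n) (leaf n b c i)"
proof -
  let ?G = "G_graph n"
  define p where "p x = (if x = hub b then hub (\<not> b) else if x = spoke b i then rim c i
    else if x = rim (\<not> c) i then spoke (\<not> b) i else x)" for x
  have "p x \<in> verts ?G \<and> dominates ?G x (p x) \<and> (\<forall>z\<in>leaf n b c i. dominates ?G z (p x) \<longrightarrow> z = x)"
    if x: "x \<in> leaf n b c i" for x
  proof (intro conjI ballI impI)
    show "p x \<in> verts ?G" "dominates ?G x (p x)"
      using x i by (cases x rule: gvertex_cases; auto simp: p_def dominates_def)+
    fix z assume "z \<in> leaf n b c i" "dominates ?G z (p x)"
    with x i show "z = x"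
      by (cases x rule: gvertex_cases; cases z rule: gvertex_cases)
        (auto simp: p_def dominates_def split: if_splits)
  qed
  moreover have "x \<in> verts ?G" if "x \<in> leaf n b c i" for x
    using that i by (cases x rule: gvertex_cases) auto
  ultimately show ?thesis unfolding irredundant_iff by blast
qed

section \<open>Counting over the blocks\<close>

definition block :: "nat \<Rightarrow> gvertex set" where
  "block i = {spoke True i, spoke False i, rim True i, rim False i}"

lemma mem_block [simp]:
  "spoke b j \<in> block i \<longleftrightarrow> j = i" "rim c j \<in> block i \<longleftrightarrow> j = i" "hub b \<notin> block i"
  by (auto simp: block_def)

text \<open>The two hubs and the 4-cycles \<open>block i\<close> partition the vertex set.\<close>

lemma card_G_graph_subset:
  assumes "S \<subseteq> verts (G_graph n)"
  shows "card S = card (S \<inter> {hub True, hub False}) + (\<Sum>i=1..n. card (S \<inter> block i))"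
proof -
  have "S = (S \<inter> {hub True, hub False}) \<union> (\<Union>i\<in>{1..n}. S \<inter> block i)" (is "_ = ?H \<union> ?B")
  proof
    show "S \<subseteq> ?H \<union> ?B"
    proof
      fix x assume "x \<in> S"
      with assms show "x \<in> ?H \<union> ?B" by (cases x rule: gvertex_cases) auto
    qed
  qed auto
  moreover have "card (?H \<union> ?B) = card ?H + card ?B"
    by (rule card_Un_disjoint) (auto simp: block_def)
  moreover have "card ?B = (\<Sum>i=1..n. card (S \<inter> block i))"
    by (rule card_UN_disjoint) (auto simp: block_def)
  ultimately show ?thesis by simp
qed

lemma irredundantE:
  assumes "irredundant (G_graph n) S" "x \<in> S"
  obtains y where "y \<in> verts (G_graph n)" "dominates (G_graph n) x y"
    "\<And>z. z \<in> S \<Longrightarrow> dominates (G_graph n) z y \<Longrightarrow> z = x"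
  using assms unfolding irredundant_iff by blast

text \<open>A rim vertex dominates only itself and the two spokes of its index, and each of these is
  dominated by one of the spokes.\<close>

lemma irredundant_spokes_rim:
  assumes S: "irredundant (G_graph n) S" and "spoke b i \<in> S" "spoke (\<not> b) i \<in> S"
  shows "rim c i \<notin> S"
proof
  assume r: "rim c i \<in> S"
  with S have i: "i \<in> {1..n}" by (force simp: irredundant_iff)
  from S r obtain y where y: "dominates (G_graph n) (rim c i) y"
    "\<And>z. z \<in> S \<Longrightarrow> dominates (G_graph n) z y \<Longrightarrow> z = rim c i" by (rule irredundantE) blast
  show False using y(1) i y(2)[OF assms(2)] y(2)[OF assms(3)]
    by (cases y rule: gvertex_cases) (auto simp: dominates_def)
qed

text \<open>Nothing is private to \<open>rim c i\<close>: the other rim vertex dominates both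
  spokes, and \<open>spoke b i\<close> dominates \<open>rim c i\<close> itself.\<close>

lemma irredundant_rims_spoke:
  assumes S: "irredundant (G_graph n) S" and "rim c i \<in> S" "rim (\<not> c) i \<in> S"
  shows "spoke b i \<notin> S"
proof
  assume r: "spoke b i \<in> S"
  with S have i: "i \<in> {1..n}" by (force simp: irredundant_iff)
  from S assms(2) obtain y where y: "dominates (G_graph n) (rim c i) y"
    "\<And>z. z \<in> S \<Longrightarrow> dominates (G_graph n) z y \<Longrightarrow> z = rim c i" by (rule irredundantE) blast
  show False using y(1) r assms(3) i y(2)[OF r] y(2)[OF assms(3)]
    by (cases y rule: gvertex_cases) (auto simp: dominates_def)
qed

text \<open>Three vertices of a block are both spokes with a rim vertex, or both rim vertices with a
  spoke.\<close>

lemma card_block_le: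
  assumes S: "irredundant (G_graph n) S"
  shows "card (S \<inter> block i) \<le> 2"
proof -
  note sr = irredundant_spokes_rim[OF S, of True i, simplified]
  note rs = irredundant_rims_spoke[OF S, of True i, simplified]
  show ?thesis using sr[of True] sr[of False] rs[of True] rs[of False]
    by (simp add: block_def Int_insert_right card_insert_if)
qed

text \<open>Each hub pays for itself: its private neighbour is a spoke, and most of the block of
  that spoke has to be absent. The blocks then hold at most \<open>2 * n - 2\<close>
  vertices.\<close>

lemma card_both_hubs_le:
  assumes S: "irredundant (G_graph n) S" and u: "hub True \<in> S" and v: "hub False \<in> S"
  shows "card S \<le> 2 * n"
proof -
  let ?G = "G_graph n"
  \<comment> \<open>The hubs dominate each other, so a private neighbour of a hub has to be one of
    its spokes.\<close>
  have ex: "\<exists>i\<in>{1..n}. \<forall>z\<in>S. dominates ?G z (spoke b i) \<longrightarrow> z = hub b" for b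
  proof -
    have bS: "hub b \<in> S" "hub (\<not> b) \<in> S" using u v by (cases b; simp)+
    from S bS(1) obtain y where y: "y \<in> verts ?G" "dominates ?G (hub b) y"
      "\<And>z. z \<in> S \<Longrightarrow> dominates ?G z y \<Longrightarrow> z = hub b" by (rule irredundantE) blast
    from y(1,2) y(3)[OF bS(2)] obtain i where "y = spoke b i" "i \<in> {1..n}"
      by (cases y rule: gvertex_cases) (auto simp: dominates_def)
    with y show ?thesis by blast
  qed
  from ex[of True] obtain i where i: "i \<in> {1..n}"
    "\<And>z. z \<in> S \<Longrightarrow> dominates ?G z (spoke True i) \<Longrightarrow> z = hub True" by blast
  from ex[of False] obtain j where j: "j \<in> {1..n}"
    "\<And>z. z \<in> S \<Longrightarrow> dominates ?G z (spoke False j) \<Longrightarrow> z = hub False" by blast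
  \<comment> \<open>All vertices of the block except the opposite spoke dominate
    \<open>spoke True i\<close>.\<close>
  have "S \<inter> block i \<subseteq> {spoke False i}"
    using i(1) i(2)[of "spoke True i"] i(2)[of "rim True i"] i(2)[of "rim False i"]
    by (auto simp: block_def dominates_def)
  from card_mono[OF _ this] have ci: "card (S \<inter> block i) \<le> 1" by simp
  have "S \<inter> block j \<subseteq> {spoke True j}"
    using j(1) j(2)[of "spoke False j"] j(2)[of "rim True j"] j(2)[of "rim False j"]
    by (auto simp: block_def dominates_def)
  from card_mono[OF _ this] have cj: "card (S \<inter> block j) \<le> 1" by simp
  have "(\<Sum>k=1..n. card (S \<inter> block k)) + 2 \<le> 2 * n"
  proof (cases "i = j")
    case True
    \<comment> \<open>Each of the two private neighbours rules out the one vertex that the other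
      would allow.\<close>
    have "S \<inter> block i = {}"
      using i(1) i(2)[of "spoke True i"] i(2)[of "rim True i"] i(2)[of "rim False i"]
        j(2)[of "spoke False j"] True
      by (auto simp: block_def dominates_def)
    then have "(\<Sum>k=1..n. card (S \<inter> block k)) = (\<Sum>k\<in>{1..n}-{i}. card (S \<inter> block k))"
      using i(1) by (subst sum.remove[of _ i]) auto
    also have "\<dots> \<le> (\<Sum>k\<in>{1..n}-{i}. 2)"
      by (intro sum_mono card_block_le[OF S])
    finally show ?thesis using i(1) by (cases n) simp_all
  next
    case False
    have "(\<Sum>k=1..n. card (S \<inter> block k)) =
        card (S \<inter> block i) + (card (S \<inter> block j) + (\<Sum>k\<in>{1..n}-{i}-{j}. card (S \<inter> block k)))"
      using i(1) j(1) False by (subst sum.remove[of _ i], simp, simp, subst sum.remove[of _ j]) auto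
    also have "(\<Sum>k\<in>{1..n}-{i}-{j}. card (S \<inter> block k)) \<le> (\<Sum>k\<in>{1..n}-{i}-{j}. 2)"
      by (intro sum_mono card_block_le[OF S])
    finally have "(\<Sum>k=1..n. card (S \<inter> block k)) \<le> 2 + 2 * (n - 2)"
      using i(1) j(1) False ci cj by simp
    \<comment> \<open>Two distinct indices exist, so \<open>n - 2\<close> is not truncated.\<close>
    moreover have "2 \<le> n" using i(1) j(1) False by simp
    ultimately show ?thesis by simp
  qed
  moreover have "S \<inter> {hub True, hub False} = {hub True, hub False}" using u v by auto
  moreover have "S \<subseteq> verts ?G" using S by (simp add: irredundant_def)
  note card_G_graph_subset[OF this]
  ultimately show ?thesis by simp
qed

section \<open>Classification of the large irredundant sets\<close>

text \<open>The inequality \<open>large\<close>, in place of an equality, lets one classification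
  give both the value of \<open>IR\<close> and the sets that attain it.\<close>

lemma irredundant_classification:
  assumes S: "irredundant (G_graph n) S" and large: "card S \<ge> 2 * n + 1"
  obtains (centre) b where "S = centre n b"
    | (leaf) b c i where "i \<in> {1..n}" "S = leaf n b c i"
proof -
  let ?G = "G_graph n"
  have sub: "S \<subseteq> verts ?G" using S by (simp add: irredundant_def)
  have blocks_le: "(\<Sum>i=1..n. card (S \<inter> block i)) \<le> 2 * n"
    using sum_mono[of "{1..n}" "\<lambda>i. card (S \<inter> block i)" "\<lambda>_. 2"] card_block_le[OF S] by simp
  have "\<not> (hub True \<in> S \<and> hub False \<in> S)"
    using card_both_hubs_le[OF S] large by auto
  moreover have "hub True \<in> S \<or> hub False \<in> S"
    using large blocks_le card_G_graph_subset[OF sub] by (cases "S \<inter> {hub True, hub False} = {}") auto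
  ultimately obtain b where b: "hub b \<in> S" "hub (\<not> b) \<notin> S" by (metis (full_types))
  then have "S \<inter> {hub True, hub False} = {hub b}" by (cases b) auto
  with large card_G_graph_subset[OF sub] have "(\<Sum>i=1..n. 2) \<le> (\<Sum>i=1..n. card (S \<inter> block i))"
    by simp
  \<comment> \<open>The sum reaches its maximum, so no block falls short of two vertices.\<close>
  then have two: "card (S \<inter> block i) = 2" if "i \<in> {1..n}" for i
    using that card_block_le[OF S]
    by (metis (no_types, lifting) finite_atLeastAtMost leD le_neq_implies_less sum_strict_mono_ex1)
  have two_iff: "card (S \<inter> block i) = of_bool (spoke True i \<in> S) + of_bool (spoke False i \<in> S) +
      of_bool (rim True i \<in> S) + of_bool (rim False i \<in> S)" for i
    by (simp add: block_def Int_insert_right card_insert_if)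
  have not_only: "\<not> S \<inter> block i \<subseteq> {x}" if "i \<in> {1..n}" for i x
    using two[OF that] card_mono[of "{x}" "S \<inter> block i"] by auto
  \<comment> \<open>A spoke opposite to \<open>hub b\<close> forces out the rim vertices of its
    block, so both spokes are present. The private neighbour of \<open>spoke b i\<close> is then
    some \<open>spoke (\<not> b) j\<close> with \<open>j\<close> different from \<open>i\<close>,
    which leaves at most one vertex in block \<open>j\<close>.\<close>
  have opp: "spoke (\<not> b) i \<notin> S" for i
  proof
    assume a: "spoke (\<not> b) i \<in> S"
    with sub have i: "i \<in> {1..n}" by auto
    \<comment> \<open>The opposite spoke dominates \<open>rim c i\<close> and itself, and
      \<open>hub b\<close> dominates \<open>spoke b i\<close>, so nothing is private to
      \<open>rim c i\<close>.\<close>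
    have r: "rim c i \<notin> S" for c
    proof
      assume r: "rim c i \<in> S"
      from S r obtain y where y: "dominates ?G (rim c i) y"
        "\<And>z. z \<in> S \<Longrightarrow> dominates ?G z y \<Longrightarrow> z = rim c i" by (rule irredundantE) blast
      show False using y(1) i y(2)[OF a] y(2)[OF b(1)]
        by (cases y rule: gvertex_cases) (auto simp: dominates_def)
    qed
    with two[OF i] have s: "spoke b i \<in> S" unfolding two_iff by (cases b) (auto simp: of_bool_def split: if_splits)
    from S s obtain y where y: "y \<in> verts ?G" "dominates ?G (spoke b i) y"
      "\<And>z. z \<in> S \<Longrightarrow> dominates ?G z y \<Longrightarrow> z = spoke b i" by (rule irredundantE) blast
    from y(1,2) y(3)[OF a] y(3)[OF b(1)] i obtain j where j: "y = spoke (\<not> b) j" "j \<noteq> i" "j \<in> {1..n}"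
      by (cases y rule: gvertex_cases) (auto simp: dominates_def)
    have "S \<inter> block j \<subseteq> {spoke b j}"
      using y(3)[of "spoke (\<not> b) j"] y(3)[of "rim True j"] y(3)[of "rim False j"] j
      by (cases b) (auto simp: dominates_def block_def)
    with not_only j show False by blast
  qed
  \<comment> \<open>The block of \<open>spoke b i\<close> also contains a rim vertex. It dominates
    itself, \<open>spoke b i\<close> and the opposite spoke; these are also dominated by
    \<open>spoke b i\<close>, \<open>hub b\<close> and, since \<open>i\<close> and \<open>j\<close>
    differ, \<open>spoke b j\<close>.\<close>
  have uniq: "j = i" if a: "spoke b i \<in> S" and a': "spoke b j \<in> S" for i j
  proof (rule ccontr)
    assume "j \<noteq> i"
    from a a' sub have i: "i \<in> {1..n}" "j \<in> {1..n}" by auto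
    from two[OF i(1)] a opp[of i] obtain c where r: "rim c i \<in> S"
      unfolding two_iff by (cases b) (auto simp: of_bool_def split: if_splits)
    from S r obtain y where y: "dominates ?G (rim c i) y"
      "\<And>z. z \<in> S \<Longrightarrow> dominates ?G z y \<Longrightarrow> z = rim c i" by (rule irredundantE) blast
    show False
    proof (cases y rule: gvertex_cases)
      case (spoke b' k)
      with y(1) have "k = i" by (simp add: dominates_def)
      with spoke i \<open>j \<noteq> i\<close> y(2)[OF b(1)] y(2)[OF a'] show False
        by (cases "b' = b") (simp_all add: dominates_def)
    qed (use y(1) y(2)[OF a] i in \<open>auto simp: dominates_def\<close>)
  qed
  have full: "rim c i \<in> S" if "i \<in> {1..n}" "spoke b i \<notin> S" for c i
    using two[OF that(1)] that(2) opp[of i] unfolding two_iff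
    by (cases b; cases c) (auto simp: of_bool_def split: if_splits)
  have rng: "j \<in> {1..n}" if "rim c j \<in> S" for c j using sub that by auto
  show thesis
  proof (cases "\<exists>i. spoke b i \<in> S")
    case False
    have "x \<in> S \<longleftrightarrow> x \<in> centre n b" for x
    proof (cases x rule: gvertex_cases)
      case (hub b') then show ?thesis using b by (cases b; cases b') simp_all
    next
      case (spoke b' j) then show ?thesis using opp[of j] False by (cases b; cases b') simp_all
    next
      case (rim c j)
      have "rim c j \<in> S \<longleftrightarrow> j \<in> {1..n}" using full rng False by blast
      with rim show ?thesis by simp
    qed
    then show thesis using centre by blast
  next
    case True
    then obtain i where a: "spoke b i \<in> S" by blast
    with sub have i: "i \<in> {1..n}" by auto
    \<comment> \<open>Next to \<open>spoke b i\<close> there is room for exactly one rim vertex; the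
      missing one supplies the parameter \<open>c\<close>.\<close>
    from two[OF i] a opp[of i] obtain c where c: "rim c i \<notin> S" "rim (\<not> c) i \<in> S"
      unfolding two_iff by (cases b) (auto simp: of_bool_def split: if_splits)
    have "x \<in> S \<longleftrightarrow> x \<in> leaf n b c i" for x
    proof (cases x rule: gvertex_cases)
      case (hub b') then show ?thesis using b by (cases b; cases b') simp_all
    next
      case (spoke b' j) then show ?thesis using opp[of j] a uniq[OF a, of j] by (cases b; cases b') auto
    next
      case (rim c' j)
      show ?thesis
      proof (cases "j = i")
        case True
        with rim c i show ?thesis by (cases c; cases c') simp_all
      next
        case False
        with uniq[OF a] have "rim c' j \<in> S \<longleftrightarrow> j \<in> {1..n}" using full rng by blast
        with rim False show ?thesis by simp
      qed
    qed
    then show thesis using leaf i by blast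
  qed
qed

section \<open>The value of IR and the IR-sets\<close>

lemma IR_G_graph: "IR (G_graph n) = 2 * n + 1"
proof (rule antisym)
  obtain S where S: "irredundant (G_graph n) S" "card S = IR (G_graph n)"
    using IR_attained(1)[OF simple_graph_G_graph] by blast
  show "IR (G_graph n) \<le> 2 * n + 1"
  proof (rule ccontr)
    assume *: "\<not> ?thesis"
    with S have "2 * n + 1 \<le> card S" by simp
    with S(1) show False
      by (rule irredundant_classification) (use * S(2) in \<open>auto simp: card_centre card_leaf\<close>)
  qed
  show "2 * n + 1 \<le> IR (G_graph n)"
    using IR_attained(2)[OF simple_graph_G_graph irredundant_centre] card_centre by metis
qed

lemma IR_sets_G_graph:
  "IR_sets (G_graph n) = {S. (\<exists>b. S = centre n b) \<or> (\<exists>b c i. i \<in> {1..n} \<and> S = leaf n b c i)}"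
proof -
  have "(\<exists>b. S = centre n b) \<or> (\<exists>b c i. i \<in> {1..n} \<and> S = leaf n b c i)"
    if "irredundant (G_graph n) S" "card S = 2 * n + 1" for S
    using irredundant_classification[OF that(1)] that(2) by (metis order_refl)
  then show ?thesis
    by (auto simp: IR_sets_def IR_G_graph irredundant_centre irredundant_leaf card_centre card_leaf)
qed

section \<open>The double star\<close>

text \<open>The isomorphism is easiest to give on the double star, whose vertices are a side and a
  number, while \<open>graph_iso\<close> asks for a map out of the IR-graph.\<close>

lemma graph_iso_inv:
  assumes bij: "bij_betw g (verts H) (verts G)"
    and adj: "\<And>p q. p \<in> verts H \<Longrightarrow> q \<in> verts H \<Longrightarrow> adj G (g p) (g q) \<longleftrightarrow> adj H p q"
  shows "graph_iso G H"
  unfolding graph_iso_def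
proof (intro exI conjI ballI)
  let ?f = "inv_into (verts H) g"
  show f: "bij_betw ?f (verts G) (verts H)" using bij by (rule bij_betw_inv_into)
  fix x y assume "x \<in> verts G" "y \<in> verts G"
  then show "adj G x y \<longleftrightarrow> adj H (?f x) (?f y)"
    using adj[of "?f x" "?f y"] bij f
    by (metis bij_betw_apply bij_betw_inv_into_right)
qed

definition side :: "bool \<Rightarrow> nat \<Rightarrow> nat + nat" where
  "side b k = (if b then Inl k else Inr k)"

lemma side_cases: obtains b k where "p = side b k"
proof (cases p)
  case (Inl k) then show ?thesis using that[of True k] by (simp add: side_def)
next
  case (Inr k) then show ?thesis using that[of False k] by (simp add: side_def)
qed

lemma verts_double_star: "side b k \<in> verts (double_star m m) \<longleftrightarrow> k \<le> m"
  by (auto simp: side_def double_star_def star_def)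

lemma edges_double_star:
  "edges (double_star k m) = (\<lambda>i. {Inl 0, Inl i}) ` {1..k} \<union> (\<lambda>i. {Inr 0, Inr i}) ` {1..m}
    \<union> {{Inl 0, Inr 0}}"
  unfolding double_star_def star_def by (simp only: setcompr_eq_image Collect_mem_eq graph.simps, simp add: image_image)

lemma adj_double_star:
  "adj (double_star m m) (side b k) (side b' l) \<longleftrightarrow>
    (if b = b' then (k = 0 \<and> l \<in> {1..m}) \<or> (l = 0 \<and> k \<in> {1..m}) else k = 0 \<and> l = 0)"
proof -
  have "adj (double_star m m) (side b k) (side b' l) \<longleftrightarrow>
      (\<exists>i\<in>{1..m}. {side b k, side b' l} = {Inl 0, Inl i}) \<or>
      (\<exists>i\<in>{1..m}. {side b k, side b' l} = {Inr 0, Inr i}) \<or>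
      {side b k, side b' l} = {Inl 0, Inr 0}"
    by (simp only: adj_def edges_double_star Un_iff image_iff singleton_iff disj_assoc)
  then show ?thesis
    by (cases b; cases b'; simp only: side_def doubleton_eq_iff sum.simps if_True if_False simp_thms; blast)
qed

section \<open>Adjacency in the IR-graph\<close>

lemma adj_IR_centre_centre: "adj (IR_graph (G_graph n)) (centre n b) (centre n b') \<longleftrightarrow> b \<noteq> b'"
proof -
  have 1: "centre n b \<in> IR_sets (G_graph n)" "centre n b' \<in> IR_sets (G_graph n)"
    by (auto simp: IR_sets_G_graph)
  have "centre n b' = centre n b - {hub b} \<union> {hub b'}" by (auto simp: centre_def)
  then have "b \<noteq> b' \<Longrightarrow> \<exists>x\<in>centre n b. \<exists>y\<in>centre n b' - {x}. adj (G_graph n) x y \<and>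
      centre n b' = (centre n b - {x}) \<union> {y}"
    by (intro bexI[of _ "hub b"] bexI[of _ "hub b'"]) auto
  moreover have "b \<noteq> b'" if "adj (IR_graph (G_graph n)) (centre n b) (centre n b')"
    using that adj_IR_graph[OF simple_graph_G_graph 1] by blast
  ultimately show ?thesis
    using adj_IR_graph[OF simple_graph_G_graph 1] by blast
qed

text \<open>On the same side, \<open>rim c i\<close> is exchanged for its neighbour
  \<open>spoke b i\<close>. Across sides, the hub and the spoke would both be new, but an exchange
  brings in only one vertex.\<close>

lemma adj_IR_centre_leaf:
  assumes i: "i \<in> {1..n}"
  shows "adj (IR_graph (G_graph n)) (centre n b) (leaf n b' c i) \<longleftrightarrow> b = b'"
proof -
  have 1: "centre n b \<in> IR_sets (G_graph n)" "leaf n b' c i \<in> IR_sets (G_graph n)"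
    using i by (auto simp: IR_sets_G_graph)
  have "leaf n b c i = centre n b - {rim c i} \<union> {spoke b i}" by (auto simp: centre_def leaf_def)
  then have "b = b' \<Longrightarrow> \<exists>x\<in>centre n b. \<exists>y\<in>leaf n b' c i - {x}. adj (G_graph n) x y \<and>
      leaf n b' c i = (centre n b - {x}) \<union> {y}"
    using i by (intro bexI[of _ "rim c i"] bexI[of _ "spoke b i"]) auto
  moreover have "b = b'" if eq: "leaf n b' c i = (centre n b - {x}) \<union> {y}" for x y
  proof (rule ccontr)
    assume "b \<noteq> b'"
    then have "hub b' \<in> leaf n b' c i - centre n b" "spoke b' i \<in> leaf n b' c i - centre n b" by auto
    with eq have "hub b' = y" "spoke b' i = y" by blast+
    then show False by auto
  qed
  ultimately show ?thesis using adj_IR_graph[OF simple_graph_G_graph 1] by blast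
qed

text \<open>A change of hub or of index introduces two new vertices. With both fixed, only the two
  rim vertices could be exchanged, and these are not adjacent.\<close>

lemma adj_IR_leaf_leaf:
  assumes i: "i \<in> {1..n}" "j \<in> {1..n}"
  shows "\<not> adj (IR_graph (G_graph n)) (leaf n b c i) (leaf n b' c' j)"
proof
  assume "adj (IR_graph (G_graph n)) (leaf n b c i) (leaf n b' c' j)"
  moreover have "leaf n b c i \<in> IR_sets (G_graph n)" "leaf n b' c' j \<in> IR_sets (G_graph n)"
    using i by (auto simp: IR_sets_G_graph)
  ultimately obtain x y where xy: "x \<in> leaf n b c i" "y \<in> leaf n b' c' j" "y \<noteq> x" "adj (G_graph n) x y"
    "leaf n b' c' j = leaf n b c i - {x} \<union> {y}"
    using adj_IR_graph[OF simple_graph_G_graph] by blast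
  have new: "z = y" if "z \<in> leaf n b' c' j" "z \<notin> leaf n b c i" for z using that xy by blast
  have old: "z = x" if "z \<notin> leaf n b' c' j" "z \<in> leaf n b c i" for z using that xy by blast
  have b: "b' = b" using new[of "hub b'"] new[of "spoke b' j"] by auto
  have j: "j = i"
  proof (rule ccontr)
    assume "j \<noteq> i"
    then have "spoke b' j = y" "rim c i = y" using i by (auto intro: new)
    then show False by auto
  qed
  show False
  proof (cases "c' = c")
    case True
    then have "leaf n b' c' j = leaf n b c i" using b j by simp
    with xy show False by blast
  next
    case False
    then have "y = rim c i" "x = rim c' j" using b j i new[of "rim c i"] old[of "rim c' j"] by auto
    with xy(4) show False by simp
  qed
qed

lemma adj_commute: "adj G x y \<longleftrightarrow> adj G y x"
  by (simp add: adj_def insert_commute)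

lemma centre_inj: "centre n b = centre n b' \<longleftrightarrow> b = b'"
proof
  assume eq: "centre n b = centre n b'"
  have "hub b \<in> centre n b'" by (simp flip: eq)
  then show "b = b'" by simp
qed simp

lemma centre_neq_leaf: "centre n b \<noteq> leaf n b' c i"
  by (metis mem_centre(2) mem_leaf(2))

lemma leaf_inj:
  assumes "i \<in> {1..n}"
  shows "leaf n b c i = leaf n b' c' j \<longleftrightarrow> b = b' \<and> c = c' \<and> i = j"
proof
  assume eq: "leaf n b c i = leaf n b' c' j"
  have "rim c i \<notin> leaf n b' c' j" by (simp flip: eq)
  moreover have "spoke b i \<in> leaf n b' c' j" by (simp flip: eq)
  ultimately show "b = b' \<and> c = c' \<and> i = j" using assms by simp
qed simp

section \<open>The isomorphism\<close>

text \<open>Matches the numbering of \<open>star (2 * n)\<close>: 0 for the centre, then the sets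
  lacking a vertex of C, then those lacking a vertex of D.\<close>

definition IR_set_at :: "nat \<Rightarrow> bool \<Rightarrow> nat \<Rightarrow> gvertex set" where
  "IR_set_at n b k = (if k = 0 then centre n b else if k \<le> n then leaf n b True k
    else leaf n b False (k - n))"

lemma IR_set_at_0 [simp]: "IR_set_at n b 0 = centre n b"
  by (simp add: IR_set_at_def)

lemma IR_set_at_cases:
  assumes "k \<le> 2 * n"
  obtains "k = 0"
    | c i where "i \<in> {1..n}" "k = (if c then i else n + i)" "\<And>b. IR_set_at n b k = leaf n b c i"
proof -
  consider "k = 0" | "k \<noteq> 0" "k \<le> n" | "n < k" by linarith
  then show ?thesis
  proof cases
    case 1 then show ?thesis using that(1) by simp
  next
    case 2 then show ?thesis using that(2)[of k True] by (simp add: IR_set_at_def)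
  next
    case 3 then show ?thesis using that(2)[of "k - n" False] assms by (simp add: IR_set_at_def Suc_le_eq)
  qed
qed

lemma IR_set_at_inj:
  assumes k: "k \<le> 2 * n" and l: "l \<le> 2 * n"
  shows "IR_set_at n b k = IR_set_at n b' l \<longleftrightarrow> b = b' \<and> k = l"
  using k
proof (cases rule: IR_set_at_cases)
  case k: 1
  from l show ?thesis
    by (cases rule: IR_set_at_cases) (auto simp: k centre_inj centre_neq_leaf)
next
  case k: (2 c i)
  from l show ?thesis
    by (cases rule: IR_set_at_cases)
      (use k in \<open>auto simp: centre_neq_leaf[symmetric] leaf_inj split: if_splits\<close>)
qed

text \<open>Both graphs join the two centres, join each centre to the leaves of its own side, and
  have no other edges.\<close>

lemma adj_IR_set_at:
  assumes k: "k \<le> 2 * n" and l: "l \<le> 2 * n"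
  shows "adj (IR_graph (G_graph n)) (IR_set_at n b k) (IR_set_at n b' l) \<longleftrightarrow>
    adj (double_star (2 * n) (2 * n)) (side b k) (side b' l)"
  using k
proof (cases rule: IR_set_at_cases)
  case k: 1
  from l show ?thesis
    by (cases rule: IR_set_at_cases)
      (auto simp: k adj_double_star adj_IR_centre_centre adj_IR_centre_leaf)
next
  case k: (2 c i)
  from l show ?thesis
  proof (cases rule: IR_set_at_cases)
    case 1
    then show ?thesis using k adj_IR_centre_leaf[OF k(1), of b' b c]
      by (subst adj_commute) (auto simp: adj_double_star)
  next
    case (2 c' j)
    then show ?thesis using k by (auto simp: adj_IR_leaf_leaf adj_double_star)
  qed
qed

lemma IR_sets_eq_IR_set_at:
  "IR_sets (G_graph n) = {IR_set_at n b k | b k. k \<le> 2 * n}"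
proof
  show "IR_sets (G_graph n) \<subseteq> {IR_set_at n b k | b k. k \<le> 2 * n}"
  proof
    fix S assume "S \<in> IR_sets (G_graph n)"
    then consider (centre) b where "S = centre n b" | (leaf) b c i where "i \<in> {1..n}" "S = leaf n b c i"
      by (auto simp: IR_sets_G_graph)
    then show "S \<in> {IR_set_at n b k | b k. k \<le> 2 * n}"
    proof cases
      case centre
      then have "S = IR_set_at n b 0" by (simp add: IR_set_at_def)
      then show ?thesis by blast
    next
      case leaf
      then have "S = IR_set_at n b (if c then i else n + i)" by (auto simp: IR_set_at_def)
      moreover have "(if c then i else n + i) \<le> 2 * n" using leaf by auto
      ultimately show ?thesis by blast
    qed
  qed
  show "{IR_set_at n b k | b k. k \<le> 2 * n} \<subseteq> IR_sets (G_graph n)"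
  proof clarify
    fix b k assume "k \<le> 2 * n"
    then show "IR_set_at n b k \<in> IR_sets (G_graph n)"
      by (cases rule: IR_set_at_cases) (simp_all add: IR_sets_G_graph, blast+)
  qed
qed

theorem mainTheorem2:
  fixes n :: nat
  assumes "n \<ge> 1"
  shows "IR (G_graph n) = 2 * n + 1
    \<and> graph_iso (IR_graph (G_graph n)) (double_star (2 * n) (2 * n))"
proof
  let ?H = "double_star (2 * n) (2 * n)"
  \<comment> \<open>The left star carries the sets containing \<open>VU\<close>, the right star
    those containing \<open>VV\<close>.\<close>
  define g where "g = case_sum (IR_set_at n True) (IR_set_at n False)"
  have g: "g (side b k) = IR_set_at n b k" for b k by (simp add: g_def side_def)
  show "graph_iso (IR_graph (G_graph n)) ?H"
  proof (rule graph_iso_inv)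
    have "inj_on g (verts ?H)"
    proof (rule inj_onI)
      fix p q assume "p \<in> verts ?H" "q \<in> verts ?H" "g p = g q"
      then show "p = q"
        by (cases p rule: side_cases; cases q rule: side_cases)
          (simp add: verts_double_star g IR_set_at_inj)
    qed
    moreover have "g ` verts ?H = IR_sets (G_graph n)"
      unfolding IR_sets_eq_IR_set_at
    proof (intro subset_antisym subsetI)
      fix S assume "S \<in> g ` verts ?H"
      then obtain p where p: "p \<in> verts ?H" "S = g p" by blast
      obtain b k where "p = side b k" by (rule side_cases)
      with p show "S \<in> {IR_set_at n b k | b k. k \<le> 2 * n}"
        by (auto simp: g verts_double_star)
    next
      fix S assume "S \<in> {IR_set_at n b k | b k. k \<le> 2 * n}"
      then obtain b k where "k \<le> 2 * n" "S = g (side b k)" using g by blast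
      then show "S \<in> g ` verts ?H" by (simp add: verts_double_star)
    qed
    ultimately show "bij_betw g (verts ?H) (verts (IR_graph (G_graph n)))"
      by (simp add: bij_betw_def IR_graph_def)
    show "adj (IR_graph (G_graph n)) (g p) (g q) \<longleftrightarrow> adj ?H p q"
      if "p \<in> verts ?H" "q \<in> verts ?H" for p q
      using that
      by (cases p rule: side_cases; cases q rule: side_cases)
        (simp add: verts_double_star g adj_IR_set_at)
  qed
qed (rule IR_G_graph)

end
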